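(* Let $(X,\mathcal{T})$ be a simple rational dynamical system, let $k\in\mathbb{N}$ and let $k_1<k_2$ be arbitrary real numbers. Then for every $\varepsilon>0$ there exist $\beta\in\mathbb{Q}\setminus\mathbb{Z}$ and $\gamma\in\mathbb{Z}^\ast$ with $dom^+(\beta)=\emptyset=dom^-(\gamma)$ and $\max dom^-(\beta)<k_1<k_2<\min dom^+(\gamma)$, and there exists $x_0\in X$, such that $\mathcal{T}^{p\beta+q\gamma}(x_0)\in B(x_0,\varepsilon)$ for all integers $0\leq p,q\leq k$.
   Context: Notation: $\mathbb{N}=\{1,2,\ldots\}$, $\mathbb{Z}^\ast=\mathbb{Z}\setminus\{0\}$; $B(x,\varepsilon)$ is the open ball of radius $\varepsilon$ about $x$. Expansion of rationals: every rational number $q$ has a unique expression $q=\sum_{s=1}^{\infty}q_{-s}\frac{(-1)^{s}}{(s+1)!}+\sum_{r=1}^{\infty}q_{r}(-1)^{r+1}r!$ with integers $0\leq q_{-s}\leq s$ for $s\geq 1$ and $0\leq q_r\leq r$ for $r\geq 1$, all but finitely many of which are zero. Put $dom(q)=\{t\in\mathbb{Z}^\ast: q_t\neq 0\}$, $dom^-(q)=\{t\in dom(q): t<0\}$, $dom^+(q)=\{t\in dom(q): t>0\}$. Simple rational dynamical system: let $X$ be a non-empty compact metric space and $\{T_n\}_{n\in\mathbb{Z}^\ast}$ a family of pairwise commuting continuous maps $X\to X$. For a non-zero rational $q$ with $dom(q)=\{t_1<\ldots<t_l\}$ put $\mathcal{T}^q(x)=T_{t_1}^{q_{t_1}}\cdots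 T_{t_l}^{q_{t_l}}(x)$, and put $\mathcal{T}^0(x)=x$, for $x\in X$. Then $\mathcal{T}=(\mathcal{T}^q)_{q\in\mathbb{Q}}$ is the rational indexed family defined from $\{T_n\}_{n\in\mathbb{Z}^\ast}$, and $(X,\mathcal{T})$ is called a simple rational dynamical system. *)

theory Defs
  imports "HOL-Analysis.Analysis"
begin

text \<open>
  Digit sequences are indexed by all of \<^typ>\<open>int\<close>; the unused index \<open>0\<close> carries the digit \<open>0\<close>,
  so that the expansion of a rational number is unique as a function (\<open>ex1_expansion\<close> below).
  The two sums are the two series of the expansion, restricted to their nonzero terms.
\<close>

definition is_expansion :: "rat \<Rightarrow> (int \<Rightarrow> nat) \<Rightarrow> bool" where
  "is_expansion q d \<longleftrightarrow>
     d 0 = 0 \<and>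
     finite {t. d t \<noteq> 0} \<and>
     (\<forall>s::nat\<ge>1. d (- int s) \<le> s) \<and>
     (\<forall>r::nat\<ge>1. d (int r) \<le> r) \<and>
     q = (\<Sum>s | s \<ge> 1 \<and> d (- int s) \<noteq> 0. of_nat (d (- int s)) * ((-1) ^ s / fact (s + 1)))
       + (\<Sum>r | r \<ge> 1 \<and> d (int r) \<noteq> 0. of_nat (d (int r)) * ((-1) ^ (r + 1) * fact r))"

definition digit :: "rat \<Rightarrow> int \<Rightarrow> nat" where
  "digit q = (THE d. is_expansion q d)"

definition rdom :: "rat \<Rightarrow> int set" where
  "rdom q = {t. t \<noteq> 0 \<and> digit q t \<noteq> 0}"

definition rdom_neg :: "rat \<Rightarrow> int set" where
  "rdom_neg q = {t \<in> rdom q. t < 0}"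

definition rdom_pos :: "rat \<Rightarrow> int set" where
  "rdom_pos q = {t \<in> rdom q. t > 0}"

definition rational_family :: "(int \<Rightarrow> 'a \<Rightarrow> 'a) \<Rightarrow> rat \<Rightarrow> 'a \<Rightarrow> 'a" where
  "rational_family T q = foldr (\<lambda>t f. (T t ^^ digit q t) \<circ> f) (sorted_list_of_set (rdom q)) id"

text \<open>
  The space is a compact subset \<open>X\<close> of a metric space type. Values of the maps outside \<open>X\<close>, and
  the map \<open>T 0\<close>, are irrelevant.
\<close>

definition simple_rational_system :: "'a::metric_space set \<Rightarrow> (rat \<Rightarrow> 'a \<Rightarrow> 'a) \<Rightarrow> bool" where
  "simple_rational_system X \<T> \<longleftrightarrow>
     X \<noteq> {} \<and> compact X \<and>
     (\<exists>T :: int \<Rightarrow> 'a \<Rightarrow> 'a.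
        (\<forall>n. n \<noteq> 0 \<longrightarrow> T n ` X \<subseteq> X \<and> continuous_on X (T n)) \<and>
        (\<forall>m n. m \<noteq> 0 \<longrightarrow> n \<noteq> 0 \<longrightarrow> (\<forall>x\<in>X. T m (T n x) = T n (T m x))) \<and>
        (\<forall>q. \<forall>x\<in>X. \<T> q x = rational_family T q x))"


subsection \<open>Existence and uniqueness of the expansion\<close>

definition weight :: "int \<Rightarrow> rat" where
  "weight t = (if t < 0 then (-1) ^ nat (- t) / fact (nat (- t) + 1)
               else (-1) ^ (nat t + 1) * fact (nat t))"

definition next_index :: "int \<Rightarrow> int" where
  "next_index t = (if t = -1 then 1 else t + 1)"

lemma weight_next:
  assumes "t \<noteq> 0"
  shows "weight (next_index t) = - of_int (\<bar>t\<bar> + 1) * weight t"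
proof -
  consider "t > 0" | "t = -1" | "t < -1" using assms by linarith
  then show ?thesis
  proof cases
    case 1
    then obtain n where "t = int n" using zero_less_imp_eq_int by blast
    moreover have "nat (int n + 1) = Suc n" by simp
    ultimately show ?thesis using 1
      by (simp add: weight_def next_index_def algebra_simps)
  next
    case 2
    then show ?thesis by (simp add: weight_def next_index_def)
  next
    case 3
    define n where "n = nat (- t - 2)"
    have t: "t = - (int n + 2)" using 3 by (simp add: n_def)
    have e: "nat (- t) = n + 2" "nat (- (t + 1)) = n + 1" using t by auto
    define x :: rat where "x = of_nat n + 3"
    define F :: rat where "F = fact (n + 1 + 1)"
    have "x > 0" by (simp add: x_def add_nonneg_pos)
    then have x0: "x \<noteq> 0" by simp
    have F0: "F \<noteq> 0" by (simp add: F_def)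
    have f: "fact (n + 2 + 1) = x * F" by (simp add: x_def F_def algebra_simps)
    have a: "of_int (\<bar>t\<bar> + 1) = x" using t by (simp add: x_def)
    have w1: "weight (next_index t) = (-1) ^ (n + 1) / F"
      using 3 e by (simp add: weight_def next_index_def F_def)
    have w2: "weight t = (-1) ^ (n + 2) / (x * F)"
      using 3 e unfolding f[symmetric] by (simp add: weight_def)
    show ?thesis unfolding w1 w2 a using x0 F0 by simp
  qed
qed

lemma weight_nonzero: "weight t \<noteq> 0"
  by (simp add: weight_def)

lemma weight_dvd:
  assumes "t \<noteq> 0" "u > t" "u \<noteq> 0"
  shows "\<exists>m::int. weight u = of_int ((\<bar>t\<bar> + 1) * m) * weight t"
proof -
  have "u \<noteq> 0 \<longrightarrow> (\<exists>m::int. weight u = of_int ((\<bar>t\<bar> + 1) * m) * weight t)"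
    if "u \<ge> t + 1" for u
    using that
  proof (induction u rule: int_ge_induct)
    case base
    show ?case
    proof
      assume "t + 1 \<noteq> 0"
      then have "next_index t = t + 1" by (simp add: next_index_def)
      then show "\<exists>m::int. weight (t + 1) = of_int ((\<bar>t\<bar> + 1) * m) * weight t"
        using weight_next[OF assms(1)] by (intro exI[of _ "-1"]) simp
    qed
  next
    case (step i)
    show ?case
    proof
      assume i: "i + 1 \<noteq> 0"
      show "\<exists>m::int. weight (i + 1) = of_int ((\<bar>t\<bar> + 1) * m) * weight t"
      proof (cases "i = 0")
        case True
        show ?thesis
        proof (cases "t = -1")
          case True
          then show ?thesis using \<open>i = 0\<close> weight_next[OF assms(1)]
            by (intro exI[of _ "-1"]) (simp add: next_index_def)
        next
          case False
          with step True assms have t: "t < -1" by auto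
          have "weight (-1) = - 1 / 2" "weight 1 = 1" by (auto simp: weight_def)
          moreover have "\<exists>m::int. weight (-1) = of_int ((\<bar>t\<bar> + 1) * m) * weight t"
          proof -
            have "\<exists>m::int. weight v = of_int ((\<bar>t\<bar> + 1) * m) * weight t"
              if "t + 1 \<le> v" "v < 0" for v
              using that
            proof (induction v rule: int_ge_induct)
              case base
              then have "next_index t = t + 1" by (simp add: next_index_def)
              then show ?case using weight_next[OF assms(1)]
                by (intro exI[of _ "-1"]) simp
            next
              case (step v)
              then obtain m where m: "weight v = of_int ((\<bar>t\<bar> + 1) * m) * weight t" by auto
              have "next_index v = v + 1" "v \<noteq> 0" using step by (auto simp: next_index_def)
              then have "weight (v + 1) = - of_int (\<bar>v\<bar> + 1) * weight v"
                using weight_next by metis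
              then show ?case unfolding m
                by (intro exI[of _ "- (\<bar>v\<bar> + 1) * m"]) (simp add: algebra_simps)
            qed
            then show ?thesis using t by auto
          qed
          then obtain m where "weight (-1) = of_int ((\<bar>t\<bar> + 1) * m) * weight t" by blast
          ultimately show ?thesis using True
            by (intro exI[of _ "-2 * m"]) simp
        qed
      next
        case False
        then obtain m where m: "weight i = of_int ((\<bar>t\<bar> + 1) * m) * weight t"
          using step by auto
        have "next_index i = i + 1" using i by (simp add: next_index_def)
        then have "weight (i + 1) = - of_int (\<bar>i\<bar> + 1) * weight i"
          using weight_next False by metis
        then show ?thesis unfolding m
          by (intro exI[of _ "- (\<bar>i\<bar> + 1) * m"]) (simp add: algebra_simps)
      qed
    qed
  qed
  then show ?thesis using assms by auto
qed

lemma is_expansion_weight: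
  "is_expansion q d \<longleftrightarrow>
     finite {t. d t \<noteq> 0} \<and> (\<forall>t. int (d t) \<le> \<bar>t\<bar>) \<and>
     q = (\<Sum>t | d t \<noteq> 0. of_nat (d t) * weight t)"
proof -
  have bounds: "d 0 = 0 \<and> (\<forall>s::nat\<ge>1. d (- int s) \<le> s) \<and> (\<forall>r::nat\<ge>1. d (int r) \<le> r)
      \<longleftrightarrow> (\<forall>t. int (d t) \<le> \<bar>t\<bar>)" (is "?L \<longleftrightarrow> ?R")
  proof
    assume L: ?L
    show ?R
    proof
      fix t :: int
      consider "t = 0" | "t > 0" | "t < 0" by linarith
      then show "int (d t) \<le> \<bar>t\<bar>"
      proof cases
        case 1 then show ?thesis using L by simp
      next
        case 2
        then have "d (int (nat t)) \<le> nat t" using L by (metis zero_less_nat_eq Suc_leI One_nat_def)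
        then show ?thesis using 2 by simp
      next
        case 3
        then have "d (- int (nat (- t))) \<le> nat (- t)"
          using L by (metis zero_less_nat_eq Suc_leI One_nat_def neg_0_less_iff_less)
        then show ?thesis using 3 by simp
      qed
    qed
  next
    assume R: ?R
    show ?L
    proof (intro conjI allI impI)
      show "d 0 = 0" using R[rule_format, of 0] by simp
      show "d (- int s) \<le> s" for s using R[rule_format, of "- int s"] by simp
      show "d (int r) \<le> r" for r using R[rule_format, of "int r"] by simp
    qed
  qed
  have sums: "(\<Sum>t | d t \<noteq> 0. of_nat (d t) * weight t) =
      (\<Sum>s | s \<ge> 1 \<and> d (- int s) \<noteq> 0. of_nat (d (- int s)) * ((-1) ^ s / fact (s + 1)))
    + (\<Sum>r | r \<ge> 1 \<and> d (int r) \<noteq> 0. of_nat (d (int r)) * ((-1) ^ (r + 1) * fact r))"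
    if fin: "finite {t. d t \<noteq> 0}" and d0: "d 0 = 0"
  proof -
    have split: "{t. d t \<noteq> 0} = {t. d t \<noteq> 0 \<and> t < 0} \<union> {t. d t \<noteq> 0 \<and> t > 0}"
    proof -
      have "t < 0 \<or> t > 0" if "d t \<noteq> 0" for t using that d0 by (cases "t = 0") auto
      then show ?thesis by blast
    qed
    have neg: "(\<Sum>t | d t \<noteq> 0 \<and> t < 0. of_nat (d t) * weight t) =
      (\<Sum>s | s \<ge> 1 \<and> d (- int s) \<noteq> 0. of_nat (d (- int s)) * ((-1) ^ s / fact (s + 1)))"
      by (rule sum.reindex_bij_witness[of _ "\<lambda>s. - int s" "\<lambda>t. nat (- t)"])
        (auto simp: weight_def)
    have pos: "(\<Sum>t | d t \<noteq> 0 \<and> t > 0. of_nat (d t) * weight t) =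
      (\<Sum>r | r \<ge> 1 \<and> d (int r) \<noteq> 0. of_nat (d (int r)) * ((-1) ^ (r + 1) * fact r))"
      by (rule sum.reindex_bij_witness[of _ "\<lambda>s. int s" "\<lambda>t. nat t"])
        (auto simp: weight_def)
    have "(\<Sum>t | d t \<noteq> 0. of_nat (d t) * weight t) =
        (\<Sum>t | d t \<noteq> 0 \<and> t < 0. of_nat (d t) * weight t)
      + (\<Sum>t | d t \<noteq> 0 \<and> t > 0. of_nat (d t) * weight t)"
      using fin by (subst split, intro sum.union_disjoint) (auto elim: rev_finite_subset)
    then show ?thesis by (simp only: neg pos)
  qed
  show ?thesis
  proof (cases "finite {t. d t \<noteq> 0} \<and> d 0 = 0")
    case True
    then show ?thesis
      unfolding is_expansion_def sums[OF conjunct1[OF True] conjunct2[OF True]] using bounds by blast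
  next
    case False
    then show ?thesis unfolding is_expansion_def using bounds by blast
  qed
qed

lemma expansion_unique:
  assumes "is_expansion q d" "is_expansion q e"
  shows "d = e"
proof (rule ccontr)
  assume "d \<noteq> e"
  define S where "S = {t. d t \<noteq> 0} \<union> {t. e t \<noteq> 0}"
  define D where "D = {t. d t \<noteq> e t}"
  have finS: "finite S" using assms by (simp add: S_def is_expansion_weight)
  have DS: "D \<subseteq> S" by (auto simp: D_def S_def)
  have finD: "finite D" using DS finS finite_subset by blast
  have neD: "D \<noteq> {}" using \<open>d \<noteq> e\<close> by (auto simp: D_def)
  have bd: "int (d t) \<le> \<bar>t\<bar>" "int (e t) \<le> \<bar>t\<bar>" for t
    using assms by (auto simp: is_expansion_weight)
  have "q = (\<Sum>t\<in>S. of_nat (d t) * weight t)"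
    using assms(1) finS unfolding is_expansion_weight S_def
    by (auto intro!: sum.mono_neutral_left)
  moreover have "q = (\<Sum>t\<in>S. of_nat (e t) * weight t)"
    using assms(2) finS unfolding is_expansion_weight S_def
    by (auto intro!: sum.mono_neutral_left)
  ultimately have "(\<Sum>t\<in>S. of_int (int (d t) - int (e t)) * weight t) = 0"
    by (simp add: algebra_simps sum_subtractf)
  moreover have "(\<Sum>t\<in>S. of_int (int (d t) - int (e t)) * weight t)
      = (\<Sum>t\<in>D. of_int (int (d t) - int (e t)) * weight t)"
    using finS DS by (intro sum.mono_neutral_right) (auto simp: D_def)
  ultimately have zero: "(\<Sum>t\<in>D. of_int (int (d t) - int (e t)) * weight t) = 0" by simp
  define m where "m = Min D"
  have mD: "m \<in> D" using finD neD by (simp add: m_def)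
  have m0: "m \<noteq> 0" using mD bd[of 0] by (auto simp: D_def)
  have "\<exists>k::int. weight t = of_int ((\<bar>m\<bar> + 1) * k) * weight m" if "t \<in> D - {m}" for t
  proof (rule weight_dvd[OF m0])
    show "t > m" using that finD by (auto simp: m_def order_less_le)
    show "t \<noteq> 0" using that bd[of 0] by (auto simp: D_def)
  qed
  then obtain k :: "int \<Rightarrow> int"
    where k: "weight t = of_int ((\<bar>m\<bar> + 1) * k t) * weight m" if "t \<in> D - {m}" for t
    by metis
  define K where "K = (\<Sum>t\<in>D - {m}. (int (d t) - int (e t)) * k t)"
  have "(\<Sum>t\<in>D - {m}. of_int (int (d t) - int (e t)) * weight t)
      = (\<Sum>t\<in>D - {m}. of_int ((\<bar>m\<bar> + 1) * ((int (d t) - int (e t)) * k t)) * weight m)"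
    by (rule sum.cong) (simp_all only: k, simp add: algebra_simps)
  also have "\<dots> = of_int ((\<bar>m\<bar> + 1) * K) * weight m"
    unfolding K_def sum_distrib_left of_int_sum sum_distrib_right by simp
  finally have "of_int (int (d m) - int (e m) + (\<bar>m\<bar> + 1) * K) * weight m = 0"
    using zero finD mD by (simp add: sum.remove[of D m] algebra_simps)
  then have "int (d m) - int (e m) + (\<bar>m\<bar> + 1) * K = 0"
    using weight_nonzero[of m] by (simp only: mult_eq_0_iff of_int_eq_0_iff) simp
  then have "(\<bar>m\<bar> + 1) dvd (int (d m) - int (e m))"
    by (intro dvdI[of _ _ "- K"]) simp
  moreover have "\<bar>int (d m) - int (e m)\<bar> < \<bar>m\<bar> + 1" using bd[of m] by linarith
  ultimately have "int (d m) - int (e m) = 0"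
    using dvd_imp_le_int[of "int (d m) - int (e m)" "\<bar>m\<bar> + 1"] by linarith
  then show False using mD by (simp add: D_def)
qed

lemma expansion_exists_from:
  fixes z t :: int
  assumes "t \<noteq> 0"
  shows "\<exists>d. is_expansion (of_int z * weight t) d \<and> (\<forall>u<t. d u = 0)"
  using assms
proof (induction "nat (2 * \<bar>z\<bar>) + (if z < 0 then 1 else 0)" arbitrary: z t rule: less_induct)
  case less
  show ?case
  proof (cases "z = 0")
    case True
    then show ?thesis by (intro exI[of _ "\<lambda>_. 0"]) (simp add: is_expansion_weight)
  next
    case False
    define b where "b = \<bar>t\<bar> + 1"
    define r where "r = z mod b"
    define y where "y = - (z div b)"
    have b: "b \<ge> 2" using less.prems by (simp add: b_def)
    have r: "0 \<le> r" "r \<le> \<bar>t\<bar>"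
      using b pos_mod_bound[of b z] by (auto simp: r_def b_def)
    have z: "z = r - b * y" by (simp add: r_def y_def)
    have dec: "nat (2 * \<bar>y\<bar>) + (if y < 0 then 1 else 0)
        < nat (2 * \<bar>z\<bar>) + (if z < 0 then 1 else (0::nat))"
    proof (cases "z > 0")
      case True
      then have "z div b \<ge> 0" using b by (simp add: pos_imp_zdiv_nonneg_iff)
      moreover have "z div b * 2 \<le> z"
      proof -
        have "z div b * 2 \<le> z div b * b" using b \<open>z div b \<ge> 0\<close> by (intro mult_left_mono) auto
        also have "\<dots> \<le> z" using r z by (simp add: y_def algebra_simps)
        finally show ?thesis .
      qed
      ultimately show ?thesis using True by (auto simp: y_def)
    next
      case neg: False
      with False have "z < 0" by simp
      then have "y > 0" using b by (simp add: y_def div_neg_pos_less0)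
      moreover have "y \<le> - z"
      proof (rule ccontr)
        assume "\<not> y \<le> - z"
        then have "y \<ge> 1 - z" by simp
        then have "b * (1 - z) \<le> b * y" using b by (intro mult_left_mono) auto
        moreover have "b * (1 - z) = b - b * z" by (simp add: algebra_simps)
        moreover have "b * z \<le> 1 * z" using b \<open>z < 0\<close> by (intro mult_right_mono_neg) auto
        moreover have "b * y = r - z" using z by simp
        ultimately show False using r(2) unfolding b_def by linarith
      qed
      ultimately show ?thesis using \<open>z < 0\<close> by auto
    qed
    have nz: "next_index t \<noteq> 0" "next_index t > t"
      using less.prems by (auto simp: next_index_def)
    obtain d where d: "is_expansion (of_int y * weight (next_index t)) d"
      "\<forall>u<next_index t. d u = 0"
      using less.hyps[OF dec nz(1)] by blast
    have dt: "d t = 0" using d nz by auto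
    define e where "e = d(t := nat r)"
    have fin: "finite {u. d u \<noteq> 0}" using d by (simp add: is_expansion_weight)
    have sub: "{u. e u \<noteq> 0} \<subseteq> insert t {u. d u \<noteq> 0}" by (auto simp: e_def)
    have "(\<Sum>u | e u \<noteq> 0. of_nat (e u) * weight u)
        = (\<Sum>u\<in>insert t {u. d u \<noteq> 0}. of_nat (e u) * weight u)"
      using sub fin by (intro sum.mono_neutral_left) auto
    also have "\<dots> = of_nat (e t) * weight t + (\<Sum>u | d u \<noteq> 0. of_nat (e u) * weight u)"
      using fin dt by (intro sum.insert) auto
    also have "(\<Sum>u | d u \<noteq> 0. of_nat (e u) * weight u)
        = (\<Sum>u | d u \<noteq> 0. of_nat (d u) * weight u)"
      using dt by (intro sum.cong) (auto simp: e_def)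
    also have "\<dots> = of_int y * weight (next_index t)"
      using d by (simp add: is_expansion_weight)
    also have "of_nat (e t) * weight t + \<dots> = of_int z * weight t"
      using r unfolding weight_next[OF less.prems] z
      by (simp add: e_def b_def algebra_simps)
    finally have "of_int z * weight t = (\<Sum>u | e u \<noteq> 0. of_nat (e u) * weight u)" ..
    moreover have "finite {u. e u \<noteq> 0}" using sub fin finite_subset by blast
    moreover have "int (e u) \<le> \<bar>u\<bar>" for u
      using d r by (auto simp: e_def is_expansion_weight)
    ultimately have "is_expansion (of_int z * weight t) e"
      by (simp add: is_expansion_weight)
    moreover have "\<forall>u<t. e u = 0" using d nz by (auto simp: e_def)
    ultimately show ?thesis by blast
  qed
qed

theorem ex1_expansion: "\<exists>!d. is_expansion q d"
proof -
  obtain a b where ab: "quotient_of q = (a, b)" by (cases "quotient_of q")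
  then have b: "b > 0" and q: "q = of_int a / of_int b"
    using quotient_of_denom_pos quotient_of_div by auto
  define s where "s = nat b"
  have s: "s \<ge> 1" "int s = b" using b by (auto simp: s_def)
  have "s dvd fact (s + 1)" using s by (intro dvd_fact) auto
  then obtain c where c: "fact (s + 1) = s * c" by (elim dvdE)
  have f: "(fact (s + 1) :: rat) = of_nat s * of_nat c"
    by (metis c of_nat_fact of_nat_mult)
  have w: "weight (- int s) = (-1) ^ s / fact (s + 1)" using s(1) by (simp add: weight_def)
  have "of_nat c \<noteq> (0::rat)" using f by (metis fact_nonzero mult_zero_right)
  moreover have "(-1::rat) ^ s * (-1) ^ s = 1" by (simp flip: power_add power_mult_distrib)
  moreover have "of_int b = (of_nat s :: rat)" using s(2) by (metis of_int_of_nat_eq)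
  ultimately have "of_int (a * int c * (-1) ^ s) * weight (- int s) = q"
    unfolding w f q by simp
  then have "\<exists>d. is_expansion q d"
    using expansion_exists_from[of "- int s"] s by (metis neg_equal_0_iff_equal of_nat_eq_0_iff not_one_le_zero)
  then show ?thesis using expansion_unique by blast
qed

lemma is_expansion_digit: "is_expansion q (digit q)"
  unfolding digit_def by (rule theI'[OF ex1_expansion])

end

theory Submission
  imports Defs
begin

text \<open>
  Take \<open>\<beta>\<close> and \<open>\<gamma>\<close> with a single nonzero digit each: \<open>\<beta> = d w\<^sub>-\<^sub>n\<close> and \<open>\<gamma> = e w\<^sub>m\<close>, where \<open>w\<close> denotes
  the weights of the expansion. If \<open>k d \<le> n\<close> and \<open>k e \<le> m\<close>, no carries occur in \<open>p\<beta> + q\<gamma>\<close>, so its map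
  is \<open>A\<^sup>p\<^sup>d B\<^sup>q\<^sup>e\<close> with \<open>A = T\<^sub>-\<^sub>n\<close> and \<open>B = T\<^sub>m\<close>. Colour \<open>(i, j)\<close> by the member of a finite cover of \<open>X\<close>
  by \<open>\<epsilon>/2\<close>-balls that contains \<open>A\<^sup>i B\<^sup>j x\<close>. A two-dimensional van der Waerden theorem gives a
  monochromatic grid \<open>(a + pd, b + qe)\<close> inside a square whose side depends only on \<open>k\<close> and the number
  of balls, and not on \<open>A\<close> and \<open>B\<close>; so \<open>n\<close> and \<open>m\<close> can be chosen beforehand, larger than that side. The
  point \<open>x\<^sub>0 = A\<^sup>a B\<^sup>b x\<close> then works.
\<close>

section \<open>Van der Waerden's theorem\<close>

text \<open>
  The progression has \<open>l\<close> terms, but the next point \<open>a + l d\<close>, on which colour focusing acts, must also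
  lie below \<open>N\<close>.
\<close>

definition has_ap :: "nat \<Rightarrow> nat \<Rightarrow> (nat \<Rightarrow> 'c) \<Rightarrow> bool" where
  "has_ap l N f \<longleftrightarrow> (\<exists>a d. d > 0 \<and> a + l * d < N \<and> (\<forall>i<l. f (a + i * d) = f a))"

definition vdw :: "nat \<Rightarrow> 'c set \<Rightarrow> nat \<Rightarrow> bool" where
  "vdw l C N \<longleftrightarrow> (\<forall>f. (\<forall>x<N. f x \<in> C) \<longrightarrow> has_ap l N f)"

lemma vdwD: "vdw l C N \<Longrightarrow> \<forall>x<N. f x \<in> C \<Longrightarrow> has_ap l N f"
  by (simp add: vdw_def)

text \<open>The \<open>s\<close> progressions have different colours but share their next point
  \<open>z\<close>. The colour of \<open>z\<close> either repeats one of theirs, and that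
  progression gains a term, or is new; with finitely many colours \<open>s\<close> cannot grow
  forever.\<close>

definition focused :: "nat \<Rightarrow> nat \<Rightarrow> nat \<Rightarrow> (nat \<Rightarrow> 'c) \<Rightarrow> bool" where
  "focused l s N f \<longleftrightarrow> (\<exists>A D z. z < N \<and> inj_on (\<lambda>j. f (A j)) {..<s} \<and>
     (\<forall>j<s. D j > 0 \<and> A j + l * D j = z \<and> (\<forall>i<l. f (A j + i * D j) = f (A j))))"

text \<open>Here the next point \<open>a + l * d\<close> has the common colour too, so there are
  \<open>l + 1\<close> equal terms below \<open>N\<close>.\<close>

definition mono_ap :: "nat \<Rightarrow> nat \<Rightarrow> (nat \<Rightarrow> 'c) \<Rightarrow> bool" where
  "mono_ap l N f \<longleftrightarrow> (\<exists>a d. d > 0 \<and> a + l * d < N \<and> (\<forall>i\<le>l. f (a + i * d) = f a))"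

lemma mono_ap_shift:
  assumes "mono_ap l N (\<lambda>x. f (u + x))" "u + N \<le> M"
  shows "mono_ap l M f"
proof -
  obtain a d where "d > 0" "a + l * d < N" "\<forall>i\<le>l. f (u + (a + i * d)) = f (u + a)"
    using assms(1) by (auto simp: mono_ap_def)
  then show ?thesis using assms(2)
    unfolding mono_ap_def by (intro exI[of _ "u + a"] exI[of _ d]) (auto simp: add.assoc)
qed

text \<open>Numbering the colours reduces a finite colour set to an initial segment of
  \<open>nat\<close>. An induction over \<open>nat\<close> colours can thus be applied to block
  patterns, which are functions.\<close>

lemma vdw_transfer:
  fixes C :: "'c set"
  assumes nat: "\<And>r. \<exists>N. vdw l {..<r::nat} N" and C: "finite C"
  shows "\<exists>N. vdw l C N"
proof -
  obtain h :: "'c \<Rightarrow> nat" and r where h: "h ` C = {i. i < r}" "inj_on h C"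
    using finite_imp_inj_to_nat_seg[OF C] by blast
  obtain N where N: "vdw l {..<r} N" using nat by blast
  have "has_ap l N f" if f: "\<forall>x<N. f x \<in> C" for f
  proof -
    have "\<forall>x<N. (h \<circ> f) x \<in> {..<r}" using f h(1) by auto
    then have "has_ap l N (h \<circ> f)" by (rule vdwD[OF N])
    then obtain a d where ad: "d > 0" "a + l * d < N" "\<forall>i<l. h (f (a + i * d)) = h (f a)"
      unfolding has_ap_def comp_def by blast
    have "f (a + i * d) = f a" if "i < l" for i
    proof -
      have "i * d \<le> l * d" using that by simp
      then have "a + i * d < N" "a < N" using ad(2) by linarith+
      then show ?thesis using ad(3) f h(2) that by (meson inj_onD)
    qed
    then show ?thesis using ad unfolding has_ap_def by blast
  qed
  then show ?thesis unfolding vdw_def by blast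
qed

text \<open>
  Colour focusing: among the blocks of length \<open>N\<close>, coloured by their colour patterns, find \<open>l\<close> equally
  patterned ones in progression. Adding the block step to the \<open>s\<close> progressions inside a block keeps
  them focused, and the copies of the old focus form one more progression, of a new colour.
\<close>

lemma focused_step:
  fixes r :: nat
  assumes vdw: "\<And>r. \<exists>N. vdw l {..<r::nat} N"
    and N: "\<And>f. \<forall>x<N. f x < r \<Longrightarrow> mono_ap l N f \<or> focused l s N f"
  shows "\<exists>M. \<forall>f. (\<forall>x<M. f x < r) \<longrightarrow> mono_ap l M f \<or> focused l (Suc s) M f"
proof -
  \<comment> \<open>Extensional functions make the set of patterns finite, and equal patterns agree
    at every position of the block.\<close>
  define P where "P = ({..<N} \<rightarrow>\<^sub>E {..<r})"
  have "finite P" by (simp add: P_def finite_PiE)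
  then obtain W where W: "vdw l P W" using vdw_transfer[OF vdw] by blast
  have "mono_ap l (W * N) f \<or> focused l (Suc s) (W * N) f" if f: "\<forall>x<W * N. f x < r" for f
  proof -
    have block: "b * N + x < W * N" if "b < W" "x < N" for b x
    proof -
      have "b * N + x < Suc b * N" using that by simp
      also have "\<dots> \<le> W * N" using that by (intro mult_le_mono1) simp
      finally show ?thesis .
    qed
    have "\<forall>b<W. (\<lambda>x\<in>{..<N}. f (b * N + x)) \<in> P" using f block by (auto simp: P_def)
    then have "has_ap l W (\<lambda>b. \<lambda>x\<in>{..<N}. f (b * N + x))"
      by (rule vdwD[OF W])
    then obtain a d where d: "d > 0" and W': "a + l * d < W"
      and eq: "\<forall>i<l. (\<lambda>x\<in>{..<N}. f ((a + i * d) * N + x)) = (\<lambda>x\<in>{..<N}. f (a * N + x))"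
      unfolding has_ap_def by blast
    have eq': "f ((a + i * d) * N + x) = f (a * N + x)" if "i < l" "x < N" for i x
      using fun_cong[OF eq[rule_format, OF that(1)], of x] that(2) by simp
    define g where "g x = f (a * N + x)" for x
    have a: "a < W" using W' by simp
    have "\<forall>x<N. g x < r" using f block[OF a] by (simp add: g_def)
    from N[OF this] show ?thesis
    proof
      assume "mono_ap l N g"
      moreover have "a * N + N \<le> W * N"
        using mult_le_mono1[of "Suc a" W N] a by simp
      ultimately have "mono_ap l (W * N) f" unfolding g_def by (rule mono_ap_shift)
      then show ?thesis ..
    next
      assume "focused l s N g"
      then obtain A D z where z: "z < N" and inj: "inj_on (\<lambda>j. g (A j)) {..<s}"
        and AD: "\<forall>j<s. D j > 0 \<and> A j + l * D j = z \<and> (\<forall>i<l. g (A j + i * D j) = g (A j))"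
        unfolding focused_def by blast
      show ?thesis
      proof (cases "\<exists>j<s. g z = g (A j)")
        case True
        then obtain j where j: "j < s" "g z = g (A j)" by blast
        then have "\<forall>i\<le>l. g (A j + i * D j) = g (A j)"
          using AD by (metis le_neq_implies_less)
        then have "mono_ap l N g" using AD j z unfolding mono_ap_def by blast
        moreover have "a * N + N \<le> W * N"
          using mult_le_mono1[of "Suc a" W N] a by simp
        ultimately have "mono_ap l (W * N) f" unfolding g_def by (rule mono_ap_shift)
        then show ?thesis ..
      next
        case False
        define A' where "A' j = a * N + (if j < s then A j else z)" for j
        define D' where "D' j = d * N + (if j < s then D j else 0)" for j
        have "inj_on (\<lambda>j. f (A' j)) {..<Suc s}"
        proof -
          have "inj_on (\<lambda>j. f (A' j)) {..<s}"
            using inj by (simp add: A'_def g_def inj_on_def)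
          moreover have "f (A' s) \<notin> (\<lambda>j. f (A' j)) ` {..<s}"
            using False by (auto simp: A'_def g_def)
          ultimately show ?thesis by (simp add: lessThan_Suc)
        qed
        moreover have "D' j > 0 \<and> A' j + l * D' j = (a + l * d) * N + z \<and>
          (\<forall>i<l. f (A' j + i * D' j) = f (A' j))" if "j < Suc s" for j
        proof (cases "j < s")
          case True
          have "f (A' j + i * D' j) = f (A' j)" if i: "i < l" for i
          proof -
            \<comment> \<open>No term lies beyond the focus \<open>z\<close>, so all of them stay
              inside one block, where equality of patterns applies.\<close>
            have "A j + i * D j \<le> z" using AD True i
              by (metis add_le_mono1 add_left_mono less_imp_le_nat mult_le_mono1)
            then have "f ((a + i * d) * N + (A j + i * D j)) = f (a * N + (A j + i * D j))"
              using eq' i z by simp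
            also have "\<dots> = f (a * N + A j)" using AD True i by (simp add: g_def)
            finally show ?thesis using True by (simp add: A'_def D'_def algebra_simps)
          qed
          moreover have "A' j + l * D' j = (a + l * d) * N + (A j + l * D j)"
            using True by (simp add: A'_def D'_def algebra_simps)
          moreover have "D' j > 0" using AD True by (simp add: D'_def)
          ultimately show ?thesis using AD True by simp
        next
          case False
          have "f (A' j + i * D' j) = f (A' j)" if "i < l" for i
            using eq'[OF that z] False by (simp add: A'_def D'_def algebra_simps)
          then show ?thesis using False d z by (simp add: A'_def D'_def algebra_simps)
        qed
        \<comment> \<open>The new focus lies in block \<open>a + l * d\<close>; this is why
          \<open>has_ap\<close> also bounds the point after the last term.\<close>
        moreover have "(a + l * d) * N + z < W * N" using block W' z by simp
        ultimately have "focused l (Suc s) (W * N) f"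
          unfolding focused_def by blast
        then show ?thesis ..
      qed
    qed
  qed
  then show ?thesis by blast
qed

text \<open>Induction on the length. Colour focusing is iterated up to \<open>Suc r\<close>
  progressions; by the pigeonhole principle they cannot have distinct colours out of
  \<open>r\<close>, so a monochromatic progression with \<open>Suc l\<close> terms must
  exist.\<close>

lemma vdw_nat:
  assumes "l \<ge> 1"
  shows "\<exists>N. vdw l {..<r::nat} N"
  using assms
proof (induction l arbitrary: r rule: dec_induct)
  case base
  have "has_ap 1 2 f" for f :: "nat \<Rightarrow> nat"
    unfolding has_ap_def by (intro exI[of _ 0] exI[of _ 1]) simp
  then show ?case unfolding vdw_def by blast
next
  case (step l)
  have "\<exists>N. \<forall>f. (\<forall>x<N. f x < r) \<longrightarrow> mono_ap l N f \<or> focused l s N f" for s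
  proof (induction s)
    case 0
    have "focused l 0 1 f" for f :: "nat \<Rightarrow> nat" by (auto simp: focused_def)
    then show ?case by blast
  next
    case (Suc s)
    then show ?case using focused_step[OF step.IH] by blast
  qed
  then obtain N where N: "\<And>f. \<forall>x<N. f x < r \<Longrightarrow> mono_ap l N f \<or> focused l (Suc r) N f"
    by blast
  \<comment> \<open>Doubling makes room for one more point, since \<open>d \<le> l * d < N\<close>
    for \<open>l \<ge> 1\<close>.\<close>
  have "has_ap (Suc l) (2 * N) f" if f: "\<forall>x<2 * N. f x \<in> {..<r}" for f
  proof -
    have "\<not> focused l (Suc r) N f"
    proof
      assume "focused l (Suc r) N f"
      then obtain A D z where z: "z < N" and inj: "inj_on (\<lambda>j. f (A j)) {..<Suc r}"
        and AD: "\<forall>j<Suc r. D j > 0 \<and> A j + l * D j = z"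
        unfolding focused_def by blast
      have "f (A j) < r" if "j < Suc r" for j
      proof -
        have "A j \<le> z" using AD that by (metis le_add1)
        then show ?thesis using f z by simp
      qed
      then have "(\<lambda>j. f (A j)) ` {..<Suc r} \<subseteq> {..<r}" by blast
      then show False using card_inj_on_le[OF inj, of "{..<r}"] by force
    qed
    then have "mono_ap l N f" using N[of f] f by simp
    then obtain a d where ad: "d > 0" "a + l * d < N" "\<forall>i\<le>l. f (a + i * d) = f a"
      unfolding mono_ap_def by blast
    have "d \<le> l * d" using step.hyps by simp
    then have "a + Suc l * d < 2 * N" using ad(2) unfolding mult_Suc by linarith
    then show ?thesis using ad unfolding has_ap_def less_Suc_eq_le by blast
  qed
  then show ?case unfolding vdw_def by blast
qed

theorem van_der_Waerden:
  fixes k :: nat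
  assumes "finite C"
  obtains N where "\<forall>f. (\<forall>x<N. f x \<in> C) \<longrightarrow>
    (\<exists>a d. d > 0 \<and> a + k * d < N \<and> (\<forall>i\<le>k. f (a + i * d) = f a))"
proof -
  \<comment> \<open>The indices up to \<open>k\<close> are \<open>Suc k\<close> terms; the bound on
    the point after them is then weakened.\<close>
  obtain N where N: "vdw (Suc k) C N"
    using vdw_transfer[OF vdw_nat assms, of "Suc k"] by auto
  have ap: "\<exists>a d. d > 0 \<and> a + k * d < N \<and> (\<forall>i\<le>k. f (a + i * d) = f a)"
    if "\<forall>x<N. f x \<in> C" for f
  proof -
    have "has_ap (Suc k) N f" using vdwD[OF N that] .
    then obtain a d where "d > 0" "a + Suc k * d < N" "\<forall>i<Suc k. f (a + i * d) = f a"
      unfolding has_ap_def by blast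
    then show ?thesis by (intro exI[of _ a] exI[of _ d]) (auto simp: less_Suc_eq_le)
  qed
  show ?thesis by (intro that allI impI) (rule ap)
qed

text \<open>As \<open>d\<close> and \<open>e\<close> may differ, the one-dimensional theorem can be
  applied twice: first to the second coordinate, coloured by patterns of length \<open>M\<close>,
  then to the first coordinate inside the repeated pattern.\<close>

theorem van_der_Waerden_grid:
  fixes k :: nat
  assumes C: "finite C"
  obtains N where "\<forall>f. (\<forall>i<N. \<forall>j<N. f i j \<in> C) \<longrightarrow>
    (\<exists>a b d e. d > 0 \<and> e > 0 \<and> a + k * d < N \<and> b + k * e < N \<and>
       (\<forall>i\<le>k. \<forall>j\<le>k. f (a + i * d) (b + j * e) = f a b))"
proof -
  obtain M where M: "\<forall>f. (\<forall>x<M. f x \<in> C) \<longrightarrow>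
      (\<exists>a d. d > 0 \<and> a + k * d < M \<and> (\<forall>i\<le>k. f (a + i * d) = f a))"
    by (rule van_der_Waerden[where k = k, OF C])
  define P where "P = ({..<M} \<rightarrow>\<^sub>E C)"
  have P: "finite P" using C by (simp add: P_def finite_PiE)
  obtain W where W: "\<forall>f. (\<forall>x<W. f x \<in> P) \<longrightarrow>
      (\<exists>a d. d > 0 \<and> a + k * d < W \<and> (\<forall>i\<le>k. f (a + i * d) = f a))"
    by (rule van_der_Waerden[where k = k, OF P])
  have grid: "\<exists>a b d e. d > 0 \<and> e > 0 \<and> a + k * d < max M W \<and> b + k * e < max M W \<and>
       (\<forall>i\<le>k. \<forall>j\<le>k. f (a + i * d) (b + j * e) = f a b)"
    if f: "\<forall>i<max M W. \<forall>j<max M W. f i j \<in> C" for f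
  proof -
    have "\<forall>j<W. (\<lambda>i\<in>{..<M}. f i j) \<in> P" using f by (auto simp: P_def)
    from W[THEN spec, THEN mp, OF this] obtain b e where e: "e > 0" and b: "b + k * e < W"
      and eq: "\<forall>j\<le>k. (\<lambda>i\<in>{..<M}. f i (b + j * e)) = (\<lambda>i\<in>{..<M}. f i b)" by blast
    have "\<forall>i<M. f i b \<in> C" using f b by auto
    from M[THEN spec, THEN mp, OF this] obtain a d where d: "d > 0" and a: "a + k * d < M"
      and eq2: "\<forall>i\<le>k. f (a + i * d) b = f a b" by blast
    have "f (a + i * d) (b + j * e) = f a b" if i: "i \<le> k" and j: "j \<le> k" for i j
    proof -
      have "i * d \<le> k * d" using i by simp
      then have "a + i * d < M" using a by linarith
      then show ?thesis using fun_cong[OF eq[rule_format, OF j], of "a + i * d"] eq2 i by simp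
    qed
    moreover have "a + k * d < max M W" "b + k * e < max M W" using a b by linarith+
    ultimately show ?thesis using d e by blast
  qed
  show ?thesis by (intro that allI impI) (rule grid)
qed

section \<open>Rationals with at most two nonzero digits\<close>

lemma digit_eqI: "is_expansion q d \<Longrightarrow> digit q = d"
  using expansion_unique is_expansion_digit by blast

text \<open>Within the digit bounds the two-term sum already is an expansion, and expansions are
  unique.\<close>

lemma digit_two:
  assumes "t < 0" "0 < u" "int a \<le> \<bar>t\<bar>" "int b \<le> \<bar>u\<bar>"
  shows "digit (of_nat a * weight t + of_nat b * weight u)
    = (\<lambda>v. if v = t then a else if v = u then b else 0)"
proof (rule digit_eqI)
  let ?d = "\<lambda>v. if v = t then a else if v = u then b else 0"
  have sub: "{v. ?d v \<noteq> 0} \<subseteq> {t, u}" by auto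
  have "(\<Sum>v | ?d v \<noteq> 0. of_nat (?d v) * weight v) = (\<Sum>v\<in>{t, u}. of_nat (?d v) * weight v)"
    using sub by (intro sum.mono_neutral_left) auto
  also have "\<dots> = of_nat a * weight t + of_nat b * weight u" using assms by simp
  finally show "is_expansion (of_nat a * weight t + of_nat b * weight u) ?d"
    unfolding is_expansion_weight using assms finite_subset[OF sub] by auto
qed

text \<open>A zero exponent removes its index from \<open>rdom\<close>, in agreement with the zeroth
  iterate being the identity.\<close>

lemma rational_family_two:
  assumes "t < 0" "0 < u" "int a \<le> \<bar>t\<bar>" "int b \<le> \<bar>u\<bar>"
  shows "rational_family T (of_nat a * weight t + of_nat b * weight u) x
    = (T t ^^ a) ((T u ^^ b) x)"
proof -
  let ?q = "of_nat a * weight t + of_nat b * weight u"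
  have dom: "rdom ?q = (if a = 0 then {} else {t}) \<union> (if b = 0 then {} else {u})"
    using assms by (auto simp: rdom_def digit_two[OF assms])
  have "sorted_list_of_set (rdom ?q) = (if a = 0 then [] else [t]) @ (if b = 0 then [] else [u])"
    using assms unfolding dom by simp
  then show ?thesis
    using assms unfolding rational_family_def digit_two[OF assms] by simp
qed

text \<open>The absolute value is \<open>a / fact (\<bar>t\<bar> + 1)\<close>, strictly between 0
  and 1.\<close>

lemma weight_neg_notin_Ints:
  assumes "t < 0" "0 < a" "int a \<le> \<bar>t\<bar>"
  shows "of_nat a * weight t \<notin> \<int>"
proof
  define F :: nat where "F = fact (nat (- t) + 1)"
  have "nat (- t) + 1 \<le> F" unfolding F_def by (rule fact_ge_self)
  then have a: "a < F" using assms by linarith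
  have "\<bar>of_nat a * weight t\<bar> = of_nat a / of_nat F"
    using assms by (simp add: weight_def abs_mult abs_divide power_abs F_def del: fact_Suc)
  moreover have "0 < of_nat a / (of_nat F :: rat)" "of_nat a / of_nat F < (1 :: rat)"
    using assms a by simp_all
  moreover assume "of_nat a * weight t \<in> \<int>"
  then obtain z where "of_nat a * weight t = of_int z" by (elim Ints_cases)
  ultimately have "0 < \<bar>of_int z :: rat\<bar>" "\<bar>of_int z :: rat\<bar> < 1" by simp_all
  then have "0 < \<bar>z\<bar>" "\<bar>z\<bar> < 1" by linarith+
  then show False by simp
qed

section \<open>Recurrence\<close>

lemma funpow_mem:
  assumes "f ` X \<subseteq> X" "x \<in> X"
  shows "(f ^^ n) x \<in> X"
  using assms by (induction n) auto

text \<open>Commutation is known only on \<open>X\<close>, so both inductions use invariance to stay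
  there.\<close>

lemma funpow_commute_on:
  assumes "f ` X \<subseteq> X" "g ` X \<subseteq> X" "\<forall>x\<in>X. f (g x) = g (f x)" "x \<in> X"
  shows "(f ^^ m) ((g ^^ n) x) = (g ^^ n) ((f ^^ m) x)"
proof -
  have one: "f ((g ^^ n) y) = (g ^^ n) (f y)" if "y \<in> X" for y n
    using that by (induction n) (use assms(3) funpow_mem[OF assms(2)] in auto)
  show ?thesis
    by (induction m) (use one funpow_mem[OF assms(1,4)] in auto)
qed

text \<open>\<open>N\<close> precedes \<open>A\<close> and \<open>B\<close> because the indices of
  these maps will depend on it. Keeping \<open>k * d\<close> and \<open>k * e\<close> below
  \<open>N\<close> later rules out carries.\<close>

lemma uniform_double_recurrence:
  fixes X :: "'a::metric_space set"
  assumes "X \<noteq> {}" "compact X" "\<epsilon> > 0"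
  obtains N where "\<forall>A B. A ` X \<subseteq> X \<and> B ` X \<subseteq> X \<and> (\<forall>x\<in>X. A (B x) = B (A x)) \<longrightarrow>
    (\<exists>d e. \<exists>x\<in>X. d > 0 \<and> e > 0 \<and> k * d < N \<and> k * e < N \<and>
       (\<forall>i\<le>k. \<forall>j\<le>k. (A ^^ (i * d)) ((B ^^ (j * e)) x) \<in> ball x \<epsilon> \<inter> X))"
proof -
  obtain C where C: "finite C" "X \<subseteq> (\<Union>c\<in>C. ball c (\<epsilon> / 2))"
    using assms(2,3) unfolding compact_eq_totally_bounded by (meson half_gt_zero)
  then have "\<forall>y\<in>X. \<exists>c. c \<in> C \<and> dist c y < \<epsilon> / 2" by (auto simp: subset_iff)
  \<comment> \<open>\<open>col y\<close> is the centre of a covering ball containing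
    \<open>y\<close>, so points of equal colour are less than \<open>\<epsilon>\<close>
    apart.\<close>
  then obtain col where col: "\<And>y. y \<in> X \<Longrightarrow> col y \<in> C \<and> dist (col y) y < \<epsilon> / 2"
    unfolding bchoice_iff by blast
  obtain N where N: "\<forall>f. (\<forall>i<N. \<forall>j<N. f i j \<in> C) \<longrightarrow>
     (\<exists>a b d e. d > 0 \<and> e > 0 \<and> a + k * d < N \<and> b + k * e < N \<and>
       (\<forall>i\<le>k. \<forall>j\<le>k. f (a + i * d) (b + j * e) = f a b))"
    by (rule van_der_Waerden_grid[where k = k, OF C(1)])
  obtain x where x: "x \<in> X" using assms(1) by blast
  have rec: "\<exists>d e. \<exists>x\<in>X. d > 0 \<and> e > 0 \<and> k * d < N \<and> k * e < N \<and>
       (\<forall>i\<le>k. \<forall>j\<le>k. (A ^^ (i * d)) ((B ^^ (j * e)) x) \<in> ball x \<epsilon> \<inter> X)"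
    if A: "A ` X \<subseteq> X" and B: "B ` X \<subseteq> X" and AB: "\<forall>x\<in>X. A (B x) = B (A x)" for A B
  proof -
    define orb where "orb i j = (A ^^ i) ((B ^^ j) x)" for i j
    have orb: "orb i j \<in> X" for i j
      unfolding orb_def using funpow_mem[OF A] funpow_mem[OF B] x by blast
    have "\<forall>i<N. \<forall>j<N. col (orb i j) \<in> C" using col orb by blast
    from N[THEN spec, THEN mp, OF this] obtain a b d e
      where de: "d > 0" "e > 0" "a + k * d < N" "b + k * e < N"
      and eq: "\<forall>i\<le>k. \<forall>j\<le>k. col (orb (a + i * d) (b + j * e)) = col (orb a b)" by blast
    have "(A ^^ (i * d)) ((B ^^ (j * e)) (orb a b)) \<in> ball (orb a b) \<epsilon> \<inter> X"
      if "i \<le> k" "j \<le> k" for i j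
    proof -
      \<comment> \<open>The power of \<open>B\<close> has to pass \<open>A ^^ a\<close> before it
        can merge with \<open>B ^^ b\<close>.\<close>
      have "(B ^^ (j * e)) (orb a b) = (A ^^ a) ((B ^^ (j * e)) ((B ^^ b) x))"
        unfolding orb_def using funpow_commute_on[OF A B AB] funpow_mem[OF B x] by simp
      then have *: "(A ^^ (i * d)) ((B ^^ (j * e)) (orb a b)) = orb (a + i * d) (b + j * e)"
        by (simp add: orb_def funpow_add add.commute[of a] add.commute[of b])
      have "dist (col (orb a b)) (orb (a + i * d) (b + j * e)) < \<epsilon> / 2"
        using col[OF orb] eq that by metis
      moreover have "dist (col (orb a b)) (orb a b) < \<epsilon> / 2" using col[OF orb] by blast
      ultimately have "dist (orb a b) (orb (a + i * d) (b + j * e)) < \<epsilon>"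
        by (metis dist_commute dist_triangle_half_r)
      then show ?thesis unfolding * using orb by simp
    qed
    moreover have "k * d < N" "k * e < N" using de by linarith+
    ultimately show ?thesis using de orb by blast
  qed
  show ?thesis by (intro that allI impI, elim conjE) (rule rec)
qed

theorem theorem1p4:
  fixes X :: "'a::metric_space set" and \<T> :: "rat \<Rightarrow> 'a \<Rightarrow> 'a"
    and k :: nat and k1 k2 \<epsilon> :: real
  assumes "simple_rational_system X \<T>"
    and "k \<ge> 1"
    and "k1 < k2"
    and "\<epsilon> > 0"
  shows "\<exists>\<beta>::rat. \<exists>\<gamma>::int. \<exists>x0\<in>X.
           \<beta> \<notin> \<int> \<and> \<gamma> \<noteq> 0 \<and>
           rdom_pos \<beta> = {} \<and> rdom_neg (of_int \<gamma>) = {} \<and>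
           real_of_int (Max (rdom_neg \<beta>)) < k1 \<and>
           k2 < real_of_int (Min (rdom_pos (of_int \<gamma>))) \<and>
           (\<forall>p q :: int. 0 \<le> p \<and> p \<le> int k \<and> 0 \<le> q \<and> q \<le> int k \<longrightarrow>
              \<T> (of_int p * \<beta> + of_int q * of_int \<gamma>) x0 \<in> ball x0 \<epsilon> \<inter> X)"
proof -
  obtain T :: "int \<Rightarrow> 'a \<Rightarrow> 'a" where X: "X \<noteq> {}" "compact X"
    and T: "\<forall>n. n \<noteq> 0 \<longrightarrow> T n ` X \<subseteq> X \<and> continuous_on X (T n)"
    and comm: "\<forall>m n. m \<noteq> 0 \<longrightarrow> n \<noteq> 0 \<longrightarrow> (\<forall>x\<in>X. T m (T n x) = T n (T m x))"
    and fam: "\<forall>q. \<forall>x\<in>X. \<T> q x = rational_family T q x"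
    using assms(1) unfolding simple_rational_system_def by (elim conjE exE) (rule that)
  obtain N where N: "\<forall>A B. A ` X \<subseteq> X \<and> B ` X \<subseteq> X \<and> (\<forall>x\<in>X. A (B x) = B (A x)) \<longrightarrow>
    (\<exists>d e. \<exists>x\<in>X. d > 0 \<and> e > 0 \<and> k * d < N \<and> k * e < N \<and>
       (\<forall>i\<le>k. \<forall>j\<le>k. (A ^^ (i * d)) ((B ^^ (j * e)) x) \<in> ball x \<epsilon> \<inter> X))"
    by (rule uniform_double_recurrence[where k = k, OF X assms(4)])
  \<comment> \<open>One \<open>m\<close> yields both indices \<open>- m\<close> and
    \<open>m\<close>: \<open>N\<close> leaves room for the digits, the floors carry the indices past
    \<open>k1\<close> and \<open>k2\<close>, and the \<open>1\<close> makes this strict.\<close>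
  define m where "m = int N + \<bar>\<lfloor>k1\<rfloor>\<bar> + \<bar>\<lfloor>k2\<rfloor>\<bar> + 1"
  have m: "m > 0" "int N \<le> m" "- real_of_int m < k1" "k2 < real_of_int m"
    unfolding m_def by linarith+
  have "T (- m) ` X \<subseteq> X \<and> T m ` X \<subseteq> X \<and> (\<forall>x\<in>X. T (- m) (T m x) = T m (T (- m) x))"
    using T comm m(1) by simp_all
  from N[THEN spec, THEN spec, THEN mp, OF this] obtain d e x
    where x: "x \<in> X" and de: "d > 0" "e > 0" "k * d < N" "k * e < N"
    and rec: "\<forall>i\<le>k. \<forall>j\<le>k.
      (T (- m) ^^ (i * d)) ((T m ^^ (j * e)) x) \<in> ball x \<epsilon> \<inter> X" by blast
  have le: "i * d < N" "i * e < N" if "i \<le> k" for i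
    using de le_less_trans[OF mult_le_mono1[OF that]] by blast+
  \<comment> \<open>All multiples up to \<open>k\<close> are admissible digits, so
    \<open>p\<beta> + q\<gamma>\<close> has no carries.\<close>
  have bd: "int (i * d) \<le> \<bar>- m\<bar>" "int (i * e) \<le> \<bar>m\<bar>" if "i \<le> k" for i
    using le[OF that] m(1,2) by linarith+
  define \<beta> where "\<beta> = of_nat d * weight (- m)"
  \<comment> \<open>Weights at positive indices are integers; the second factor is
    \<open>weight m\<close> computed in \<open>int\<close>.\<close>
  define \<gamma> :: int where "\<gamma> = int e * ((-1) ^ (nat m + 1) * fact (nat m))"
  have \<gamma>: "of_int \<gamma> = of_nat e * weight m" using m(1) by (simp add: \<gamma>_def weight_def)
  have bd1: "int d \<le> \<bar>- m\<bar>" "int e \<le> \<bar>m\<bar>" using bd[of 1] assms(2) by simp_all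
  \<comment> \<open>A zero at the other index lets the two-digit formula cover
    \<open>\<beta>\<close>, and likewise \<open>\<gamma>\<close>.\<close>
  have "digit \<beta> = (\<lambda>v. if v = - m then d else 0)"
    using digit_two[of "- m" m d 0] bd1 m(1) by (simp add: \<beta>_def fun_eq_iff)
  then have dom\<beta>: "rdom \<beta> = {- m}" using de m(1) by (auto simp: rdom_def)
  have "digit (of_int \<gamma>) = (\<lambda>v. if v = m then e else 0)"
    using digit_two[of "- m" m 0 e] bd1 m(1) by (auto simp: \<gamma> fun_eq_iff)
  then have dom\<gamma>: "rdom (of_int \<gamma>) = {m}" using de m(1) by (auto simp: rdom_def)
  have doms: "rdom_neg \<beta> = {- m}" "rdom_pos \<beta> = {}"
    "rdom_neg (of_int \<gamma>) = {}" "rdom_pos (of_int \<gamma>) = {m}"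
    using m(1) by (auto simp: rdom_neg_def rdom_pos_def dom\<beta> dom\<gamma>)
  have \<beta>_notin: "\<beta> \<notin> \<int>"
    unfolding \<beta>_def using weight_neg_notin_Ints m(1) de(1) bd1(1) by simp
  have \<gamma>_nonzero: "\<gamma> \<noteq> 0" using de by (simp add: \<gamma>_def)
  have orbit: "\<T> (of_int p * \<beta> + of_int q * of_int \<gamma>) x \<in> ball x \<epsilon> \<inter> X"
    if pq: "0 \<le> p" "p \<le> int k" "0 \<le> q" "q \<le> int k" for p q :: int
  proof -
    obtain i where p: "p = int i" using pq(1) by (rule nonneg_int_cases)
    obtain j where q: "q = int j" using pq(3) by (rule nonneg_int_cases)
    have ij: "i \<le> k" "j \<le> k" using pq by (simp_all add: p q)
    have "of_int p * \<beta> + of_int q * of_int \<gamma>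
      = of_nat (i * d) * weight (- m) + of_nat (j * e) * weight m"
      unfolding \<gamma> by (simp add: \<beta>_def p q)
    then have "\<T> (of_int p * \<beta> + of_int q * of_int \<gamma>) x
      = (T (- m) ^^ (i * d)) ((T m ^^ (j * e)) x)"
      using fam[rule_format, OF x] rational_family_two[of "- m" m "i * d" "j * e" T x] bd ij m(1)
      by simp
    then show ?thesis using rec ij by simp
  qed
  have bounds: "real_of_int (Max (rdom_neg \<beta>)) < k1" "k2 < real_of_int (Min (rdom_pos (of_int \<gamma>)))"
    unfolding doms using m(3,4) by simp_all
  show ?thesis
    by (intro exI[of _ \<beta>] exI[of _ \<gamma>] bexI[of _ x] conjI allI impI)
      (rule x \<beta>_notin \<gamma>_nonzero doms bounds | elim conjE, rule orbit; assumption)+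
qed

end
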